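(* Let $\Gamma$ be a signed graph in which every connected component has at least two vertices. Then $$\eta(\Gamma) \leq \begin{cases} 2c(\Gamma)+p(\Gamma)-1, & \text{if } p(\Gamma)\geq 1;\\ 2c(\Gamma), & \text{if } p(\Gamma)=0 \text{ and } \Gamma \text{ is a cycle-disjoint signed graph};\\ 2c(\Gamma)-1, & \text{if } p(\Gamma)=0 \text{ and some two distinct cycles of } \Gamma \text{ have a common vertex}.\end{cases}$$
   Context: All graphs are simple and finite. A signed graph $\Gamma=(G,\sigma)$ consists of a simple graph $G$ (the underlying graph) and a map $\sigma:E(G)\to\{+,-\}$. Its adjacency matrix $A(\Gamma)=(a^\sigma_{ij})$ has $a^\sigma_{ij}=\sigma(v_iv_j)$ if $v_i\sim v_j$ and $0$ otherwise. The nullity $\eta(\Gamma)$ is the multiplicity of $0$ as an eigenvalue of $A(\Gamma)$. The cyclomatic number is $c(\Gamma)=|E(G)|-|V(G)|+\omega(G)$, where $\omega(G)$ is the number of connected components of $G$, and $p(\Gamma)$ is the number of pendant vertices (vertices of degree one) of $G$. $\Gamma$ is called cycle-disjoint if any two distinct cycles of $\Gamma$ (if any) have no common vertices. *)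

theory Defs
  imports "Jordan_Normal_Form.Char_Poly" "HOL-Library.FuncSet"
begin

record 'a signed_graph =
  vertices :: "'a set"
  edges :: "'a set set"
  sigma :: "'a set \<Rightarrow> int"

text \<open>The signs $+$ and $-$ are the integers \<open>1\<close> and \<open>-1\<close>; the values of \<open>sigma\<close> outside
  the edge set are irrelevant.\<close>

definition signed_graph :: "'a signed_graph \<Rightarrow> bool" where
  "signed_graph \<Gamma> \<longleftrightarrow>
     finite (vertices \<Gamma>) \<and>
     (\<forall>e\<in>edges \<Gamma>. e \<subseteq> vertices \<Gamma> \<and> card e = 2) \<and>
     sigma \<Gamma> \<in> edges \<Gamma> \<rightarrow> {1, -1}"

definition connectedness :: "'a signed_graph \<Rightarrow> ('a \<times> 'a) set" where
  "connectedness \<Gamma> =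
     {(u, v). {u, v} \<in> edges \<Gamma>}\<^sup>* \<inter> vertices \<Gamma> \<times> vertices \<Gamma>"

definition components :: "'a signed_graph \<Rightarrow> 'a set set" where
  "components \<Gamma> = vertices \<Gamma> // connectedness \<Gamma>"

definition cyclomatic_number :: "'a signed_graph \<Rightarrow> int" where
  "cyclomatic_number \<Gamma> =
     int (card (edges \<Gamma>)) - int (card (vertices \<Gamma>)) + int (card (components \<Gamma>))"

definition vertex_degree :: "'a signed_graph \<Rightarrow> 'a \<Rightarrow> nat" where
  "vertex_degree \<Gamma> v = card {e \<in> edges \<Gamma>. v \<in> e}"

definition pendant_number :: "'a signed_graph \<Rightarrow> nat" where
  "pendant_number \<Gamma> = card {v \<in> vertices \<Gamma>. vertex_degree \<Gamma> v = 1}"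

text \<open>A cycle is a subgraph without isolated vertices, so it is represented by its edge set \<open>C\<close>;
  its vertex set is \<open>\<Union>C\<close>. In particular, rotating or reversing the list \<open>xs\<close> gives the same
  cycle.\<close>

definition is_cycle :: "'a signed_graph \<Rightarrow> 'a set set \<Rightarrow> bool" where
  "is_cycle \<Gamma> C \<longleftrightarrow> C \<subseteq> edges \<Gamma> \<and>
     (\<exists>xs. distinct xs \<and> length xs \<ge> 3 \<and>
        C = {{xs ! i, xs ! (Suc i mod length xs)} | i. i < length xs})"

definition cycle_disjoint :: "'a signed_graph \<Rightarrow> bool" where
  "cycle_disjoint \<Gamma> \<longleftrightarrow>
     (\<forall>C D. is_cycle \<Gamma> C \<and> is_cycle \<Gamma> D \<and> C \<noteq> D \<longrightarrow> \<Union>C \<inter> \<Union>D = {})"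

definition adjacency_matrix :: "'a signed_graph \<Rightarrow> 'a list \<Rightarrow> real mat" where
  "adjacency_matrix \<Gamma> vs =
     mat (length vs) (length vs) (\<lambda>(i, j).
       if {vs ! i, vs ! j} \<in> edges \<Gamma> then of_int (sigma \<Gamma> {vs ! i, vs ! j}) else 0)"

text \<open>The enumeration \<open>vs\<close> of the vertices is arbitrary; lemma \<open>nullity_eq\<close> shows that the
  nullity does not depend on it.\<close>

definition nullity :: "'a signed_graph \<Rightarrow> nat" where
  "nullity \<Gamma> =
     (let vs = (SOME vs. distinct vs \<and> set vs = vertices \<Gamma>)
      in order 0 (char_poly (adjacency_matrix \<Gamma> vs)))"

lemma det_permute_rows_cols:
  fixes A :: "'a :: comm_ring_1 mat"
  assumes A: "A \<in> carrier_mat n n" and p: "p permutes {0..<n}"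
  shows "det (mat n n (\<lambda>(i, j). A $$ (p i, p j))) = det A"
proof -
  have p_less: "p i < n" if "i < n" for i
    using permutes_in_image[OF p, of i] that by simp
  define B where "B = mat n n (\<lambda>(i, j). A $$ (p i, j))"
  have B: "B \<in> carrier_mat n n" by (simp add: B_def)
  have "mat n n (\<lambda>(i, j). A $$ (p i, p j))
      = transpose_mat (mat n n (\<lambda>(i, j). transpose_mat B $$ (p i, j)))"
    by (rule eq_matI) (auto simp: B_def p_less)
  then have "det (mat n n (\<lambda>(i, j). A $$ (p i, p j)))
      = det (mat n n (\<lambda>(i, j). transpose_mat B $$ (p i, j)))"
    by (simp add: det_transpose[of _ n])
  also have "\<dots> = signof p * det (transpose_mat B)"
    by (rule det_permute_rows) (use B p in auto)
  also have "det (transpose_mat B) = signof p * det A"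
    using det_transpose[OF B] det_permute_rows[OF A p] by (simp add: B_def)
  also have "signof p * (signof p * det A) = det A"
    by (simp add: sign_def)
  finally show ?thesis .
qed

lemma char_poly_adjacency_matrix_eq:
  assumes "distinct vs" "distinct ws" "set vs = set ws"
  shows "char_poly (adjacency_matrix \<Gamma> ws) = char_poly (adjacency_matrix \<Gamma> vs)"
proof -
  have "mset vs = mset ws"
    using assms by (simp add: set_eq_iff_mset_eq_distinct)
  then obtain p where p: "p permutes {..<length vs}" and ws: "permute_list p vs = ws"
    by (metis mset_eq_permutation)
  define n where "n = length vs"
  have p': "p permutes {0..<n}" using p by (simp add: n_def atLeast0LessThan)
  have p_less: "p i < n" if "i < n" for i
    using permutes_in_image[OF p', of i] that by simp
  have p_inj: "p i = p j \<longleftrightarrow> i = j" for i j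
    using permutes_inj[OF p'] by (auto dest: injD)
  have len: "length ws = n" using ws by (auto simp: n_def)
  have nth: "ws ! i = vs ! p i" if "i < n" for i
    using that ws permute_list_nth[OF p] by (auto simp: n_def)
  have A: "adjacency_matrix \<Gamma> vs \<in> carrier_mat n n"
    by (simp add: adjacency_matrix_def n_def)
  have "char_poly_matrix (adjacency_matrix \<Gamma> ws)
      = mat n n (\<lambda>(i, j). char_poly_matrix (adjacency_matrix \<Gamma> vs) $$ (p i, p j))"
    by (rule eq_matI)
      (auto simp: char_poly_matrix_def adjacency_matrix_def len nth p_less p_inj
        simp flip: n_def)
  then show ?thesis
    using det_permute_rows_cols[OF char_poly_matrix_closed[OF A] p']
    by (simp add: char_poly_def)
qed

lemma nullity_eq:
  assumes "distinct vs" "set vs = vertices \<Gamma>"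
  shows "nullity \<Gamma> = order 0 (char_poly (adjacency_matrix \<Gamma> vs))"
proof -
  define ws where "ws = (SOME ws. distinct ws \<and> set ws = vertices \<Gamma>)"
  have "distinct ws \<and> set ws = vertices \<Gamma>"
    unfolding ws_def by (rule someI[of _ vs]) (use assms in simp)
  then show ?thesis
    using assms char_poly_adjacency_matrix_eq[of vs ws \<Gamma>]
    by (simp add: nullity_def flip: ws_def)
qed

end

theory Submission
  imports Defs
    "Jordan_Normal_Form.DL_Rank"
    "Jordan_Normal_Form.Jordan_Normal_Form_Existence"
    "Jordan_Normal_Form.Jordan_Normal_Form_Uniqueness"
begin

text \<open>
  As the adjacency matrix is symmetric, the nullity is the dimension of its kernel, so it is at most
  the size of any vertex set \<open>S\<close> such that a kernel vector vanishing on \<open>S\<close> is zero. Such a set is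
  built greedily by zero forcing: the kernel equation at \<open>v\<close> makes a kernel vector vanish at the last
  neighbour of \<open>v\<close> once it vanishes at all the others. Exploring the graph from a start vertex, each
  newly processed vertex \<open>v\<close> is adjacent to a processed one, so putting at most \<open>deg v - 2\<close> further
  vertices (truncated at \<open>0\<close>) into \<open>S\<close> suffices to process it. Starting a component at \<open>v\<close> costs at
  most \<open>2\<close> more than this, and only \<open>1\<close> more if \<open>v\<close> is pendant. Without isolated vertices
  \<open>\<Sum>v. (deg v - 2) = 2|E| - 2|V| + p\<close>, so the total cost is at most \<open>2c + p\<close>, and one less if some
  component is started at a pendant vertex or if a vertex of degree at least \<open>3\<close> is processed when two
  of its neighbours have been processed already. If two distinct cycles meet, then one of them has
  a vertex \<open>x\<close> of degree at least \<open>3\<close>, and running around this cycle before processing \<open>x\<close>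
  achieves the latter.
\<close>

section \<open>Linear algebra: the multiplicity of the eigenvalue 0 of a symmetric matrix\<close>

text \<open>If the dimension exceeded \<open>card S\<close>, restricting a basis to the coordinates
  in \<open>S\<close> would give a homogeneous system with fewer equations than unknowns. A
  nontrivial solution yields a kernel vector vanishing on \<open>S\<close>, which contradicts
  independence.\<close>

lemma kernel_dim_le_card:
  fixes B :: "'b :: field mat"
  assumes B: "B \<in> carrier_mat nr n" and S: "S \<subseteq> {..<n}"
    and zero: "\<And>v. v \<in> mat_kernel B \<Longrightarrow> (\<And>s. s \<in> S \<Longrightarrow> v $ s = 0) \<Longrightarrow> v = 0\<^sub>v n"
  shows "kernel_dim B \<le> card S"
proof (rule ccontr)
  assume less: "\<not> kernel_dim B \<le> card S"
  interpret K: kernel nr n B by unfold_locales (rule B)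
  obtain b where b: "finite b" "K.basis b"
    using kernel_basis_exists[OF B] by auto
  obtain bs where bs: "set bs = b" "distinct bs"
    using finite_distinct_list[OF b(1)] by auto
  obtain ss where ss: "set ss = S" "distinct ss"
    using finite_distinct_list[of S] finite_subset[OF S] by auto
  define m where "m = length bs"
  have "K.dim = m"
    using K.Ker.dim_basis[OF b] bs by (simp add: m_def distinct_card[symmetric])
  then have m: "length ss < m"
    using less ss by (simp add: distinct_card[symmetric])
  have bK: "b \<subseteq> mat_kernel B" and li: "\<not> K.lin_dep b"
    using b(2) by (auto simp: K.Ker.basis_def)
  have carr: "set bs \<subseteq> carrier_vec n"
    using bK bs mat_kernel_carrier[OF B] by auto
  define P where "P = mat_of_cols n bs"
  have P: "P \<in> carrier_mat n m" by (simp add: P_def m_def)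
  have cols: "cols P = bs"
    using carr by (simp add: P_def)
  \<comment> \<open>The rows of \<open>P\<close> with index in \<open>S\<close>, padded with zero
    rows to a square matrix so that the determinant criterion for a nontrivial solution
    applies.\<close>
  define M where "M = mat m m (\<lambda>(i, j). if i < length ss then P $$ (ss ! i, j) else 0)"
  have M: "M \<in> carrier_mat m m" by (simp add: M_def)
  have "M = mat\<^sub>r m m (\<lambda>i. if i = length ss then 0\<^sub>v m else row M i)"
    by (rule eq_matI) (auto simp: M_def)
  then have "det M = 0"
    using det_row_0[OF m, of "row M"] M by auto
  then obtain v where v: "v \<in> carrier_vec m" "v \<noteq> 0\<^sub>v m" "M *\<^sub>v v = 0\<^sub>v m"
    using det_0_iff_vec_prod_zero_field[OF M] by blast
  define w where "w = P *\<^sub>v v"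
  have "B * P = 0\<^sub>m nr m"
  proof (rule eq_matI)
    fix i j assume ij: "i < dim_row (0\<^sub>m nr m)" "j < dim_col (0\<^sub>m nr m)"
    have "col P j = bs ! j" using cols ij P by (metis carrier_matD(2) cols_nth index_zero_mat(3))
    moreover have "bs ! j \<in> mat_kernel B" using bK bs ij by (auto simp: m_def)
    ultimately have "B *\<^sub>v col P j = 0\<^sub>v nr" using mat_kernelD[OF B] by simp
    then have "(B *\<^sub>v col P j) $ i = 0" using ij by simp
    then show "(B * P) $$ (i, j) = 0\<^sub>m nr m $$ (i, j)" using ij B P by simp
  qed (use B P in auto)
  then have "B *\<^sub>v w = 0\<^sub>m nr m *\<^sub>v v"
    using assoc_mult_mat_vec[OF B P v(1)] by (simp add: w_def)
  also have "\<dots> = 0\<^sub>v nr"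
    using v(1) by (auto simp: scalar_prod_def)
  finally have "B *\<^sub>v w = 0\<^sub>v nr" .
  moreover have wc: "w \<in> carrier_vec n" using P v by (simp add: w_def)
  ultimately have wK: "w \<in> mat_kernel B" using mat_kernelI[OF B] by blast
  have "w $ s = 0" if s: "s \<in> S" for s
  proof -
    obtain i where i: "i < length ss" "s = ss ! i" using s ss by (metis in_set_conv_nth)
    then have "s < n" using s S by auto
    have "w $ s = (M *\<^sub>v v) $ i"
      using i m P v(1) \<open>s < n\<close> by (auto simp: w_def M_def scalar_prod_def)
    then show ?thesis using v i m by simp
  qed
  from zero[OF wK this] have "P *\<^sub>v v = 0\<^sub>v n" by (simp add: w_def)
  from K.NC.lin_depI[OF P v(1,2) this] have "K.NC.lin_dep b" using cols bs by simp
  then show False using li K.lindep_same[OF bK] by simp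
qed

text \<open>The order of \<open>a\<close> is the total size of its Jordan blocks. At that exponent
  each block contributes its full size, since no block is larger than the total.\<close>

lemma order_char_poly_eq_dim_gen_eigenspace:
  fixes A :: "complex mat"
  assumes "A \<in> carrier_mat n n"
  shows "Polynomial.order a (char_poly A) = dim_gen_eigenspace A a (Polynomial.order a (char_poly A))"
proof -
  obtain n_as where jnf: "jordan_nf A n_as"
    using char_poly_factorized[OF assms] jordan_nf_exists[OF assms] by blast
  define l where "l = map fst (filter (\<lambda>na. snd na = a) n_as)"
  have ord: "Polynomial.order a (char_poly A) = sum_list l"
    using jordan_nf_order[OF jnf] by (simp add: l_def)
  have "map (min (sum_list l)) l = l"
    by (rule map_idI) (simp add: member_le_sum_list)
  moreover have "filter (\<lambda>(n, e). e = a) n_as = filter (\<lambda>na. snd na = a) n_as"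
    by (rule filter_cong) auto
  ultimately show ?thesis
    by (simp add: dim_gen_eigenspace[OF jnf] ord flip: l_def)
qed

text \<open>With \<open>u = A v\<close>, moving \<open>A\<close> across the inner product gives
  \<open>(u, u) = (A u, v) = 0\<close>.\<close>

lemma hermitian_kernel_square:
  fixes A :: "complex mat"
  assumes A: "A \<in> carrier_mat n n" and v: "v \<in> carrier_vec n"
    and herm: "\<And>i j. i < n \<Longrightarrow> j < n \<Longrightarrow> cnj (A $$ (i, j)) = A $$ (j, i)"
    and "A *\<^sub>v (A *\<^sub>v v) = 0\<^sub>v n"
  shows "A *\<^sub>v v = 0\<^sub>v n"
proof -
  define u where "u = A *\<^sub>v v"
  have u: "u \<in> carrier_vec n" using A v by (simp add: u_def)
  have nth: "(A *\<^sub>v x) $ i = (\<Sum>j<n. A $$ (i, j) * x $ j)" if "i < n" "x \<in> carrier_vec n" for x i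
    using that A by (auto simp: scalar_prod_def lessThan_atLeast0)
  have "u \<bullet>c u = (\<Sum>i<n. u $ i * cnj (u $ i))"
    using u by (auto simp: scalar_prod_def lessThan_atLeast0)
  also have "\<dots> = (\<Sum>i<n. \<Sum>j<n. u $ i * cnj (A $$ (i, j)) * cnj (v $ j))"
    by (rule sum.cong) (use v in \<open>auto simp: u_def nth sum_distrib_left algebra_simps\<close>)
  also have "\<dots> = (\<Sum>j<n. \<Sum>i<n. A $$ (j, i) * u $ i * cnj (v $ j))"
    by (subst sum.swap) (auto intro!: sum.cong simp: herm)
  also have "\<dots> = (\<Sum>j<n. (A *\<^sub>v u) $ j * cnj (v $ j))"
    by (rule sum.cong) (use u in \<open>auto simp: nth sum_distrib_right\<close>)
  also have "\<dots> = 0"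
    using assms(4) by (simp add: u_def)
  finally show ?thesis
    using u by (simp add: u_def)
qed

text \<open>Factors of \<open>A\<close> are removed one at a time. So the generalized eigenspace of
  0 is the kernel, and algebraic and geometric multiplicity agree.\<close>

lemma hermitian_kernel_pow:
  fixes A :: "complex mat"
  assumes A: "A \<in> carrier_mat n n" and v: "v \<in> carrier_vec n"
    and herm: "\<And>i j. i < n \<Longrightarrow> j < n \<Longrightarrow> cnj (A $$ (i, j)) = A $$ (j, i)"
  shows "A ^\<^sub>m k *\<^sub>v v = 0\<^sub>v n \<Longrightarrow> A *\<^sub>v v = 0\<^sub>v n"
  using v
proof (induction k arbitrary: v)
  case 0
  then show ?case using A by (auto simp: scalar_prod_def)
next
  case (Suc k)
  have Av: "A *\<^sub>v v \<in> carrier_vec n" using A Suc.prems by simp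
  have "A ^\<^sub>m k *\<^sub>v (A *\<^sub>v v) = 0\<^sub>v n"
    using Suc.prems assoc_mult_mat_vec[OF pow_carrier_mat[OF A] A] by simp
  from Suc.IH[OF this Av] show ?case
    by (intro hermitian_kernel_square[OF A Suc.prems(2)] herm)
qed

text \<open>The matrix is read over the complex numbers, where Jordan forms exist and a real
  symmetric matrix is Hermitian; this is why \<open>f\<close> is complex-valued.\<close>

lemma order_0_char_poly_le_card:
  fixes A :: "real mat"
  assumes A: "A \<in> carrier_mat n n" and S: "S \<subseteq> {..<n}"
    and sym: "\<And>i j. i < n \<Longrightarrow> j < n \<Longrightarrow> A $$ (i, j) = A $$ (j, i)"
    and zero: "\<And>(f :: nat \<Rightarrow> complex) j.
      (\<And>i. i < n \<Longrightarrow> (\<Sum>j<n. of_real (A $$ (i, j)) * f j) = 0) \<Longrightarrow>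
      (\<And>j. j \<in> S \<Longrightarrow> f j = 0) \<Longrightarrow> j < n \<Longrightarrow> f j = 0"
  shows "Polynomial.order 0 (char_poly A) \<le> card S"
proof -
  define B where "B = map_mat complex_of_real A"
  have B: "B \<in> carrier_mat n n" using A by (simp add: B_def)
  have ch: "char_matrix B 0 = B" using B by (auto simp: char_matrix_def)
  interpret h: map_poly_inj_idom_divide_hom complex_of_real ..
  have "Polynomial.order 0 (char_poly B) = Polynomial.order 0 (char_poly A)"
    using h.order_hom[of 0 "char_poly A"] of_real_hom.char_poly_hom[OF A, where 'a = complex]
    by (simp add: B_def)
  then obtain k where "Polynomial.order 0 (char_poly A) = kernel_dim (B ^\<^sub>m k)"
    using order_char_poly_eq_dim_gen_eigenspace[OF B, of 0]
    by (auto simp: dim_gen_eigenspace_def ch)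
  also have "\<dots> \<le> card S"
  proof (rule kernel_dim_le_card[OF pow_carrier_mat[OF B] S])
    fix v assume v: "v \<in> mat_kernel (B ^\<^sub>m k)" and vS: "\<And>s. s \<in> S \<Longrightarrow> v $ s = 0"
    note v = mat_kernelD[OF pow_carrier_mat[OF B] v]
    have "B *\<^sub>v v = 0\<^sub>v n"
      by (rule hermitian_kernel_pow[OF B v(1) _ v(2)]) (use A sym in \<open>auto simp: B_def\<close>)
    moreover have "(B *\<^sub>v v) $ i = (\<Sum>j<n. of_real (A $$ (i, j)) * v $ j)" if "i < n" for i
      using that A v(1) by (auto simp: B_def scalar_prod_def lessThan_atLeast0)
    ultimately have "(\<Sum>j<n. of_real (A $$ (i, j)) * v $ j) = 0" if "i < n" for i
      using that by (metis index_zero_vec(1))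
    from zero[OF this vS] show "v = 0\<^sub>v n" using v(1) by auto
  qed
  finally show ?thesis .
qed

section \<open>Neighbours, kernel functions and forcing sets\<close>

locale finite_signed_graph =
  fixes \<Gamma> :: "'a signed_graph"
  assumes signed_graph: "signed_graph \<Gamma>"
begin

abbreviation V where "V \<equiv> vertices \<Gamma>"
abbreviation E where "E \<equiv> edges \<Gamma>"
abbreviation deg where "deg \<equiv> vertex_degree \<Gamma>"

definition nbrs :: "'a \<Rightarrow> 'a set" where
  "nbrs v = {u. {u, v} \<in> E}"

definition component :: "'a \<Rightarrow> 'a set" where
  "component v = connectedness \<Gamma> `` {v}"

text \<open>Truncation is intended: a pendant vertex counts 0 rather than -1.\<close>

definition excess :: "'a \<Rightarrow> nat" where
  "excess v = deg v - 2"

text \<open>The kernel of the adjacency matrix, written without enumerating the vertices.\<close>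

definition in_kernel :: "('a \<Rightarrow> complex) \<Rightarrow> bool" where
  "in_kernel f \<longleftrightarrow> (\<forall>v\<in>V. (\<Sum>u\<in>nbrs v. of_int (sigma \<Gamma> {u, v}) * f u) = 0)"

text \<open>\<open>X\<close> holds the processed vertices. Vanishing at their neighbours is part of
  the invariant, so that an adjacent vertex can be processed next without joining
  \<open>S\<close>.\<close>

definition forces :: "'a set \<Rightarrow> 'a set \<Rightarrow> bool" where
  "forces S X \<longleftrightarrow> S \<subseteq> V \<and> X \<subseteq> V \<and>
     (\<forall>f. in_kernel f \<longrightarrow> (\<forall>s\<in>S. f s = 0) \<longrightarrow> (\<forall>v\<in>X \<union> \<Union> (nbrs ` X). f v = 0))"

text \<open>The number \<open>d\<close> records what has been saved so far compared with the general cost estimate.\<close>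

definition cheaply_forces :: "nat \<Rightarrow> 'a set \<Rightarrow> 'a set \<Rightarrow> bool" where
  "cheaply_forces d S X \<longleftrightarrow> forces S X \<and>
     card S + d \<le> 2 * card (component ` X) + (\<Sum>v\<in>X. excess v)"

lemma finite_V: "finite V"
  and edge_subset: "e \<in> E \<Longrightarrow> e \<subseteq> V"
  and edge_card: "e \<in> E \<Longrightarrow> card e = 2"
  and edge_sign: "e \<in> E \<Longrightarrow> sigma \<Gamma> e \<in> {1, -1}"
  using signed_graph by (auto simp: signed_graph_def)

lemma finite_E: "finite E"
  by (rule finite_subset[of _ "Pow V"]) (use edge_subset finite_V in auto)

lemma nbrs_sym: "u \<in> nbrs v \<longleftrightarrow> v \<in> nbrs u"
  by (simp add: nbrs_def insert_commute)

lemma nbrs_subset: "nbrs v \<subseteq> V"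
  using edge_subset by (auto simp: nbrs_def)

lemma finite_nbrs: "finite (nbrs v)"
  using finite_subset[OF nbrs_subset finite_V] .

lemma in_V_of_nbr: "u \<in> nbrs v \<Longrightarrow> v \<in> V"
  using edge_subset by (auto simp: nbrs_def)

section \<open>Degree sums\<close>

lemma degree_eq: "deg v = card (nbrs v)"
proof -
  have "bij_betw (\<lambda>u. {u, v}) (nbrs v) {e \<in> E. v \<in> e}"
  proof (rule bij_betw_imageI)
    show "inj_on (\<lambda>u. {u, v}) (nbrs v)"
      by (auto simp: inj_on_def doubleton_eq_iff)
    have "e \<in> (\<lambda>u. {u, v}) ` nbrs v" if "e \<in> E" "v \<in> e" for e
    proof -
      have "card e = 2" using edge_card \<open>e \<in> E\<close> by blast
      then obtain a b where "e = {a, b}"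
        by (auto simp: card_2_iff)
      then obtain u where "e = {u, v}"
        using \<open>v \<in> e\<close> by (auto simp: insert_commute)
      then show ?thesis using \<open>e \<in> E\<close> by (auto simp: nbrs_def)
    qed
    then show "(\<lambda>u. {u, v}) ` nbrs v = {e \<in> E. v \<in> e}"
      by (auto simp: nbrs_def)
  qed
  then show ?thesis
    by (simp add: vertex_degree_def bij_betw_same_card)
qed

lemma sum_degree: "(\<Sum>v\<in>V. deg v) = 2 * card E"
proof -
  have "(\<Sum>v\<in>V. deg v) = (\<Sum>v\<in>V. \<Sum>e\<in>E. if v \<in> e then 1 else 0)"
    by (simp add: vertex_degree_def sum.If_cases[OF finite_E] Collect_conj_eq)
  also have "\<dots> = (\<Sum>e\<in>E. \<Sum>v\<in>V. if v \<in> e then 1 else 0)"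
    by (rule sum.swap)
  also have "\<dots> = (\<Sum>e\<in>E. 2)"
  proof (rule sum.cong)
    fix e assume e: "e \<in> E"
    then have "V \<inter> e = e" using edge_subset by blast
    then show "(\<Sum>v\<in>V. if v \<in> e then 1 else 0) = (2::nat)"
      using edge_card[OF e] by (simp add: sum.If_cases[OF finite_V])
  qed simp
  finally show ?thesis by simp
qed

text \<open>Truncation raises \<open>deg v - 2\<close> by 1 exactly at pendant vertices; the rest is
  the handshake identity.\<close>

lemma sum_excess:
  assumes "\<And>v. v \<in> V \<Longrightarrow> deg v \<ge> 1"
  shows "int (\<Sum>v\<in>V. excess v) = 2 * int (card E) - 2 * int (card V) + int (pendant_number \<Gamma>)"
proof -
  have "int (\<Sum>v\<in>V. excess v) = (\<Sum>v\<in>V. int (deg v) - 2 + (if deg v = 1 then 1 else 0))"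
    unfolding of_nat_sum by (rule sum.cong) (use assms in \<open>force simp: excess_def\<close>)+
  also have "\<dots> = int (\<Sum>v\<in>V. deg v) - 2 * int (card V) + int (pendant_number \<Gamma>)"
    by (simp add: sum.distrib sum_subtractf pendant_number_def sum.If_cases[OF finite_V] Collect_conj_eq)
  finally show ?thesis by (simp add: sum_degree)
qed

section \<open>Connected components\<close>

lemma equiv_connectedness: "equiv V (connectedness \<Gamma>)"
proof (rule equivI)
  show "refl_on V (connectedness \<Gamma>)"
    by (auto simp: refl_on_def connectedness_def)
  have "sym {(u, v). {u, v} \<in> E}"
    by (auto simp: sym_def insert_commute)
  then show "sym (connectedness \<Gamma>)"
    using sym_rtrancl[of "{(u, v). {u, v} \<in> E}"] by (auto simp: connectedness_def sym_def)
  show "trans (connectedness \<Gamma>)"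
    by (auto simp: connectedness_def trans_def intro: rtrancl_trans)
qed (auto simp: connectedness_def)

lemma components_eq: "components \<Gamma> = component ` V"
  by (auto simp: components_def quotient_def component_def)

lemma component_nbr: "u \<in> nbrs v \<Longrightarrow> component u = component v"
  unfolding component_def
  by (rule equiv_class_eq[OF equiv_connectedness])
    (use edge_subset in \<open>auto simp: connectedness_def nbrs_def\<close>)

text \<open>A set closed under neighbours contains every vertex reachable from it, so a vertex
  outside it opens a new component.\<close>

lemma component_notin_image:
  assumes "X \<subseteq> V" "\<Union> (nbrs ` X) \<subseteq> X" "v \<in> V - X"
  shows "component v \<notin> component ` X"
proof
  assume "component v \<in> component ` X"
  then obtain x where x: "x \<in> X" "component v = component x" by blast
  then have "(x, v) \<in> connectedness \<Gamma>"
    using eq_equiv_class[OF _ equiv_connectedness, of x v] assms by (auto simp: component_def)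
  then have "(x, v) \<in> {(u, v). {u, v} \<in> E}\<^sup>*"
    by (simp add: connectedness_def)
  then have "v \<in> X"
    by induction (use x assms in \<open>auto simp: nbrs_def insert_commute\<close>)
  then show False using assms by simp
qed

text \<open>A path from \<open>v\<close> to another vertex of its component begins with an edge at
  \<open>v\<close>.\<close>

lemma degree_pos:
  assumes "\<forall>K\<in>components \<Gamma>. card K \<ge> 2" "v \<in> V"
  shows "deg v \<ge> 1"
proof -
  have "card (component v) \<ge> 2"
    using assms by (auto simp: components_eq)
  then have "\<not> component v \<subseteq> {v}"
    using card_mono[of "{v}" "component v"] by fastforce
  then obtain w where w: "w \<noteq> v" "(v, w) \<in> {(u, v). {u, v} \<in> E}\<^sup>*"
    by (auto simp: component_def connectedness_def)
  then obtain u where "{v, u} \<in> E"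
    by (metis (mono_tags, lifting) case_prodD converse_rtranclE mem_Collect_eq)
  then have "u \<in> nbrs v" by (simp add: nbrs_def insert_commute)
  then show ?thesis
    using finite_nbrs[of v] by (auto simp: degree_eq Suc_le_eq card_gt_0_iff)
qed

section \<open>Greedy zero forcing and its cost\<close>

text \<open>All but one of the neighbours of \<open>v\<close> not yet known to vanish are added to
  \<open>S\<close>; the kernel equation at \<open>v\<close> settles the last one. The vertices in
  \<open>Y\<close> are known already, which bounds the number added.\<close>

lemma forces_insert:
  assumes "forces S X" and v: "v \<in> V" "v \<in> S \<union> \<Union> (nbrs ` X)"
    and Y: "Y \<subseteq> nbrs v \<inter> X"
  shows "\<exists>S'. forces S' (insert v X) \<and> card S' \<le> card S + (deg v - card Y - 1)"
proof -
  define W where "W = nbrs v - (X \<union> \<Union> (nbrs ` X))"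
  have W: "finite W" "W \<subseteq> nbrs v - Y" using finite_nbrs Y by (auto simp: W_def)
  have "card W \<le> card (nbrs v - Y)"
    by (rule card_mono) (use W finite_nbrs in auto)
  also have "\<dots> = deg v - card Y"
    using Y finite_nbrs[of v] by (subst card_Diff_subset) (auto simp: degree_eq intro: finite_subset)
  finally have cardW: "card W \<le> deg v - card Y" .
  \<comment> \<open>\<open>w\<close> is the neighbour left to be forced. If \<open>W\<close> is
    empty, nothing is added and \<open>w\<close> is an arbitrary value, possibly not a neighbour of
    \<open>v\<close>.\<close>
  obtain T w where T: "W \<subseteq> insert w T" "T \<subseteq> nbrs v - {w}" "card T \<le> card W - 1"
  proof (cases "W = {}")
    case True
    then show ?thesis using that[of undefined "{}"] by simp
  next
    case False
    then obtain w where "w \<in> W" by blast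
    then show ?thesis using that[of w "W - {w}"] W by auto
  qed
  have "f u = 0" if f: "in_kernel f" "\<forall>s\<in>S \<union> T. f s = 0"
    and u: "u \<in> insert v X \<union> \<Union> (nbrs ` insert v X)" for f u
  proof -
    have old: "f u = 0" if "u \<in> X \<union> \<Union> (nbrs ` X)" for u
      using f assms(1) that unfolding forces_def by blast
    have new: "f u = 0" if "u \<in> nbrs v - {w}" for u
    proof (cases "u \<in> W")
      case True
      then show ?thesis using f(2) T(1) that by blast
    next
      case False
      then show ?thesis using old that by (auto simp: W_def)
    qed
    \<comment> \<open>Only the term of \<open>w\<close> survives in the kernel equation at
      \<open>v\<close>, and its coefficient is 1 or -1.\<close>
    have "f w = 0" if "w \<in> nbrs v"
    proof -
      have "0 = (\<Sum>u\<in>nbrs v. of_int (sigma \<Gamma> {u, v}) * f u)"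
        using f(1) v(1) by (simp add: in_kernel_def)
      also have "\<dots> = of_int (sigma \<Gamma> {w, v}) * f w"
        using new by (subst sum.remove[OF finite_nbrs that]) simp
      finally show ?thesis
        using edge_sign[of "{w, v}"] that by (auto simp: nbrs_def)
    qed
    then show ?thesis using u old new f(2) v(2) by blast
  qed
  moreover have "S \<union> T \<subseteq> V" "insert v X \<subseteq> V"
    using assms(1) T(2) nbrs_subset v(1) by (auto simp: forces_def)
  ultimately have "forces (S \<union> T) (insert v X)"
    unfolding forces_def by blast
  moreover have "card (S \<union> T) \<le> card S + (deg v - card Y - 1)"
    using card_Un_le[of S T] T(3) cardW by linarith
  ultimately show ?thesis by blast
qed

lemma cheaply_forces_empty: "cheaply_forces 0 {} {}"
  by (simp add: cheaply_forces_def forces_def)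

text \<open>One processed neighbour keeps \<open>v\<close> in an old component at cost
  \<open>excess v\<close>; each of the \<open>e\<close> further ones saves 1. The bound
  \<open>e \<le> excess v\<close> keeps truncation from swallowing this saving.\<close>

lemma cheaply_forces_step:
  assumes "cheaply_forces d S X" "v \<in> V - X" "Y \<subseteq> nbrs v \<inter> X" "card Y = Suc e" "e \<le> excess v"
  shows "\<exists>S'. cheaply_forces (d + e) S' (insert v X)"
proof -
  have S: "forces S X" "card S + d \<le> 2 * card (component ` X) + (\<Sum>v\<in>X. excess v)"
    using assms(1) by (auto simp: cheaply_forces_def)
  have fin: "finite X"
    using S(1) finite_subset[OF _ finite_V] by (auto simp: forces_def)
  obtain y where y: "y \<in> X" "y \<in> nbrs v"
    using assms(3,4) by (cases "Y = {}") auto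
  then have "v \<in> S \<union> \<Union> (nbrs ` X)" using nbrs_sym by blast
  then obtain S' where S': "forces S' (insert v X)" "card S' \<le> card S + (deg v - card Y - 1)"
    using forces_insert[OF S(1) _ _ assms(3)] assms(2) by blast
  have "component v = component y"
    using y(2) component_nbr by simp
  then have "component ` insert v X = component ` X"
    using y(1) by (simp add: insert_absorb)
  moreover have "(\<Sum>v\<in>insert v X. excess v) = excess v + (\<Sum>v\<in>X. excess v)"
    using assms(2) fin by simp
  ultimately have "cheaply_forces (d + e) S' (insert v X)"
    using S(2) S' assms(4,5) by (simp add: cheaply_forces_def excess_def)
  then show ?thesis by blast
qed

text \<open>Choosing \<open>v\<close> costs 1 and forcing its neighbours \<open>deg v - 1\<close>,
  so at most \<open>deg v\<close> in all. The new component allows \<open>2 + excess v\<close>,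
  which leaves 1 over exactly when \<open>v\<close> is pendant.\<close>

lemma cheaply_forces_start:
  assumes "cheaply_forces d S X" "v \<in> V - X" "\<Union> (nbrs ` X) \<subseteq> X" "deg v \<ge> 1"
  shows "\<exists>S'. cheaply_forces (if deg v = 1 then Suc d else d) S' (insert v X)"
proof -
  have S: "forces S X" "card S + d \<le> 2 * card (component ` X) + (\<Sum>v\<in>X. excess v)"
    using assms(1) by (auto simp: cheaply_forces_def)
  have fin: "finite X"
    using S(1) finite_subset[OF _ finite_V] by (auto simp: forces_def)
  have "forces (insert v S) X"
    using S(1) assms(2) by (auto simp: forces_def)
  then obtain S' where S': "forces S' (insert v X)" "card S' \<le> card (insert v S) + (deg v - 1)"
    using forces_insert[of "insert v S" X v "{}"] assms(2) by auto
  have "card (insert v S) \<le> Suc (card S)"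
    by (rule card_insert_le_m1) auto
  moreover have "card (component ` insert v X) = Suc (card (component ` X))"
    using component_notin_image[OF _ assms(3,2)] S(1) fin by (simp add: forces_def)
  moreover have "(\<Sum>v\<in>insert v X. excess v) = excess v + (\<Sum>v\<in>X. excess v)"
    using assms(2) fin by simp
  ultimately have "cheaply_forces (if deg v = 1 then Suc d else d) S' (insert v X)"
    using S(2) S' assms(4) by (auto simp: cheaply_forces_def excess_def)
  then show ?thesis by blast
qed

text \<open>Exploration never spends an earlier saving: a vertex next to \<open>X\<close> is
  processed if there is one, otherwise a new component is started.\<close>

lemma cheaply_forces_complete:
  assumes "\<And>v. v \<in> V \<Longrightarrow> deg v \<ge> 1"
  shows "cheaply_forces d S X \<Longrightarrow> \<exists>S'. cheaply_forces d S' V"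
proof (induction "card (V - X)" arbitrary: S X d rule: less_induct)
  case less
  have X: "X \<subseteq> V" using less.prems by (simp add: cheaply_forces_def forces_def)
  show ?case
  proof (cases "X = V")
    case True
    then show ?thesis using less.prems by blast
  next
    case False
    have "\<exists>v S'. v \<in> V - X \<and> cheaply_forces d S' (insert v X)"
    proof (cases "\<Union> (nbrs ` X) \<subseteq> X")
      case True
      obtain v where v: "v \<in> V - X" using X \<open>X \<noteq> V\<close> by blast
      then obtain S' where "cheaply_forces (if deg v = 1 then Suc d else d) S' (insert v X)"
        using cheaply_forces_start[OF less.prems v True] assms by blast
      \<comment> \<open>Any extra saving from a pendant start is given away to keep \<open>d\<close>
        fixed.\<close>
      then have "cheaply_forces d S' (insert v X)"
        by (auto simp: cheaply_forces_def split: if_splits)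
      then show ?thesis using v by blast
    next
      case False
      then obtain v x where v: "x \<in> X" "v \<in> nbrs x" "v \<in> V - X"
        using nbrs_subset by blast
      then show ?thesis
        using cheaply_forces_step[OF less.prems v(3), of "{x}" 0] nbrs_sym by auto
    qed
    then obtain v S' where v: "v \<in> V - X" "cheaply_forces d S' (insert v X)" by blast
    have "card (V - insert v X) < card (V - X)"
      by (rule psubset_card_mono) (use v finite_V in auto)
    from less.hyps[OF this v(2)] show ?thesis .
  qed
qed

section \<open>From forcing sets to the nullity\<close>

lemma nullity_le_card:
  assumes "forces S V"
  shows "nullity \<Gamma> \<le> card S"
proof -
  obtain vs where vs: "distinct vs" "set vs = V"
    using finite_distinct_list[OF finite_V] by blast
  define n where "n = length vs"
  define A where "A = adjacency_matrix \<Gamma> vs"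
  have bij: "bij_betw ((!) vs) {..<n} V"
    using bij_betw_nth[OF vs(1)] vs(2) by (simp add: n_def)
  define I where "I = {i. i < n \<and> vs ! i \<in> S}"
  have SV: "S \<subseteq> V" using assms by (simp add: forces_def)
  have "bij_betw ((!) vs) I S"
    using bij SV by (auto simp: I_def bij_betw_def inj_on_def)
  then have card: "card I = card S" by (rule bij_betw_same_card)
  have "Polynomial.order 0 (char_poly A) \<le> card I"
  proof (rule order_0_char_poly_le_card)
    show "A \<in> carrier_mat n n"
      by (simp add: A_def adjacency_matrix_def n_def)
    show "I \<subseteq> {..<n}" by (auto simp: I_def)
    show "A $$ (i, j) = A $$ (j, i)" if "i < n" "j < n" for i j
      using that by (simp add: A_def adjacency_matrix_def n_def insert_commute)
  next
    fix f :: "nat \<Rightarrow> complex" and j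
    assume ker: "\<And>i. i < n \<Longrightarrow> (\<Sum>j<n. of_real (A $$ (i, j)) * f j) = 0"
      and zero: "\<And>j. j \<in> I \<Longrightarrow> f j = 0" and j: "j < n"
    \<comment> \<open>\<open>g\<close> carries the vector \<open>f\<close>, indexed by positions in
      \<open>vs\<close>, over to the vertices.\<close>
    define g where "g v = f (inv_into {..<n} ((!) vs) v)" for v
    have g: "g (vs ! i) = f i" if "i < n" for i
      using that bij by (simp add: g_def bij_betw_inv_into_left)
    have "in_kernel g"
      unfolding in_kernel_def
    proof
      fix v assume "v \<in> V"
      then obtain i where i: "i < n" "v = vs ! i"
        using bij by (auto simp: bij_betw_def)
      have "(\<Sum>u\<in>nbrs v. of_int (sigma \<Gamma> {u, v}) * g u)
          = (\<Sum>u\<in>V. if {u, v} \<in> E then of_int (sigma \<Gamma> {u, v}) * g u else 0)"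
        by (rule sum.mono_neutral_cong_left) (use finite_V nbrs_subset in \<open>auto simp: nbrs_def\<close>)
      also have "\<dots> = (\<Sum>j<n. of_real (A $$ (i, j)) * f j)"
        by (subst sum.reindex_bij_betw[OF bij, symmetric], rule sum.cong)
          (auto simp: g i A_def adjacency_matrix_def insert_commute simp flip: n_def)
      finally show "(\<Sum>u\<in>nbrs v. of_int (sigma \<Gamma> {u, v}) * g u) = 0"
        using ker i by simp
    qed
    moreover have "\<forall>s\<in>S. g s = 0"
    proof
      fix s assume s: "s \<in> S"
      then obtain i where "i < n" "s = vs ! i"
        using bij SV by (auto simp: bij_betw_def)
      then show "g s = 0" using zero g s by (auto simp: I_def)
    qed
    moreover have "vs ! j \<in> V" using j nth_mem[of j vs] vs(2) by (simp add: n_def)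
    ultimately have "g (vs ! j) = 0"
      using assms unfolding forces_def by blast
    then show "f j = 0" using g j by simp
  qed
  then show ?thesis
    using nullity_eq[OF vs] card by (simp add: A_def)
qed

text \<open>The full budget, 2 per component plus the sum of all excesses, equals
  \<open>2c + p\<close>; so a saving \<open>d\<close> made on any part of the graph lowers the bound
  by \<open>d\<close>.\<close>

lemma nullity_le:
  assumes "\<forall>K\<in>components \<Gamma>. card K \<ge> 2" "cheaply_forces d S X"
  shows "int (nullity \<Gamma>) \<le> 2 * cyclomatic_number \<Gamma> + int (pendant_number \<Gamma>) - int d"
proof -
  obtain S' where "cheaply_forces d S' V"
    using cheaply_forces_complete degree_pos assms by blast
  then have "int (card S') + int d \<le> 2 * int (card (components \<Gamma>)) + int (\<Sum>v\<in>V. excess v)"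
    and "nullity \<Gamma> \<le> card S'"
    by (auto simp: cheaply_forces_def components_eq nullity_le_card simp del: of_nat_sum)
  then show ?thesis
    using sum_excess degree_pos assms(1) by (simp add: cyclomatic_number_def)
qed

section \<open>Cycles and the saving from meeting cycles\<close>

text \<open>An infinite periodic walk starting at a prescribed vertex replaces the list, so that
  later arguments need no wrap-around case.\<close>

lemma is_cycle_periodic:
  assumes "is_cycle \<Gamma> C" "v \<in> \<Union>C"
  obtains k and g :: "nat \<Rightarrow> 'a" where "k \<ge> 3" "g 0 = v"
    "\<forall>i j. g i = g j \<longleftrightarrow> i mod k = j mod k" "C = range (\<lambda>i. {g i, g (Suc i)})"
proof -
  obtain xs where xs: "distinct xs" "length xs \<ge> 3"
    "C = {{xs ! i, xs ! (Suc i mod length xs)} | i. i < length xs}"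
    using assms(1) by (auto simp: is_cycle_def)
  define k where "k = length xs"
  define g where "g i = xs ! (i mod k)" for i
  have k: "k \<ge> 3" using xs by (simp add: k_def)
  then have "0 < k" by simp
  then have lt: "i mod k < length xs" for i unfolding k_def by (rule mod_less_divisor)
  have C: "C = range (\<lambda>i. {g i, g (Suc i)})"
  proof
    show "C \<subseteq> range (\<lambda>i. {g i, g (Suc i)})"
      using xs(3) by (force simp: g_def k_def)
    show "range (\<lambda>i. {g i, g (Suc i)}) \<subseteq> C"
    proof clarify
      fix i
      have "g (Suc i) = xs ! (Suc (i mod k) mod length xs)"
        by (simp add: g_def k_def mod_Suc_eq)
      then show "{g i, g (Suc i)} \<in> C"
        using xs(3) lt by (auto simp: g_def)
    qed
  qed
  have g: "g i = g j \<longleftrightarrow> i mod k = j mod k" for i j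
    unfolding g_def by (rule nth_eq_iff_index_eq) (use xs(1) lt in \<open>auto simp: k_def\<close>)
  obtain a where a: "v = g a" using assms(2) C by auto
  have shift: "(a + i) mod k = (a + j) mod k \<longleftrightarrow> i mod k = j mod k" for i j
  proof (cases "i \<le> j")
    case True
    then show ?thesis
      using mod_eq_dvd_iff_nat[of i j k] mod_eq_dvd_iff_nat[of "a + i" "a + j" k] by auto
  next
    case False
    then show ?thesis
      using mod_eq_dvd_iff_nat[of j i k] mod_eq_dvd_iff_nat[of "a + j" "a + i" k] by auto
  qed
  have "C = range (\<lambda>i. {g (a + i), g (a + Suc i)})"
  proof
    show "range (\<lambda>i. {g (a + i), g (a + Suc i)}) \<subseteq> C" using C by auto
    show "C \<subseteq> range (\<lambda>i. {g (a + i), g (a + Suc i)})"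
    proof
      fix e assume "e \<in> C"
      then obtain i where i: "e = {g i, g (Suc i)}" using C by blast
      \<comment> \<open>The index \<open>i\<close> shifted back by \<open>a\<close>, with the
        multiple \<open>a * k\<close> of the period added to stay nonnegative.\<close>
      define t where "t = i + a * k - a"
      have t: "a + t = i + a * k" using k by (cases k) (auto simp: t_def)
      then have "g i = g (a + t)" "g (Suc i) = g (a + Suc t)"
        by (simp_all add: g)
      then have "e = {g (a + t), g (a + Suc t)}" using i by simp
      then show "e \<in> range (\<lambda>i. {g (a + i), g (a + Suc i)})" by (rule image_eqI) simp
    qed
  qed
  then show ?thesis
    using that[of k "\<lambda>i. g (a + i)"] k a g shift by simp
qed

text \<open>The two cycle edges at a vertex of \<open>C\<close> exhaust its degree, so walking along
  \<open>D\<close> from a common vertex never leaves \<open>C\<close>.\<close>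

lemma cycle_edges_subset:
  assumes C: "is_cycle \<Gamma> C" and D: "is_cycle \<Gamma> D"
    and deg2: "\<And>v. v \<in> \<Union>C \<Longrightarrow> deg v \<le> 2" and meet: "\<Union>C \<inter> \<Union>D \<noteq> {}"
  shows "D \<subseteq> C"
proof -
  have closed: "{v, u} \<in> C" if v: "v \<in> \<Union>C" and e: "{v, u} \<in> E" for u v
  proof -
    obtain k g where g: "k \<ge> 3" "g 0 = v" "\<forall>i j. g i = g j \<longleftrightarrow> i mod k = j mod k"
      "C = range (\<lambda>i. {g i, g (Suc i)})"
      using is_cycle_periodic[OF C v] by blast
    have CE: "C \<subseteq> E" using C by (simp add: is_cycle_def)
    have edges: "{v, g 1} \<in> C" "{g (k - 1), v} \<in> C"
    proof -
      show "{v, g 1} \<in> C" using g(2,4) by auto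
      have "g (Suc (k - 1)) = v" using g(1,2) g(3)[rule_format, of k 0] by simp
      then show "{g (k - 1), v} \<in> C" using g(4) by (metis rangeI)
    qed
    \<comment> \<open>The two cycle neighbours of \<open>v\<close> differ because
      \<open>k \<ge> 3\<close>.\<close>
    have "g 1 \<noteq> g (k - 1)" using g(1) g(3)[rule_format, of 1 "k - 1"] by simp
    then have "card (nbrs v) \<le> card {g 1, g (k - 1)}"
      using deg2[OF v] by (simp add: degree_eq)
    moreover have "{g 1, g (k - 1)} \<subseteq> nbrs v"
      using edges CE by (auto simp: nbrs_def insert_commute)
    ultimately have "{g 1, g (k - 1)} = nbrs v"
      by (intro card_seteq finite_nbrs)
    moreover have "u \<in> nbrs v" using e by (simp add: nbrs_def insert_commute)
    ultimately have "u = g 1 \<or> u = g (k - 1)" by blast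
    then show ?thesis using edges by (metis insert_commute)
  qed
  obtain x where x: "x \<in> \<Union>C" "x \<in> \<Union>D" using meet by blast
  obtain h where h: "h 0 = x" and D_eq: "D = range (\<lambda>i::nat. {h i, h (Suc i)})"
    using is_cycle_periodic[OF D x(2)] by blast
  have DE: "D \<subseteq> E" using D by (simp add: is_cycle_def)
  have edge: "{h i, h (Suc i)} \<in> C" if "h i \<in> \<Union>C" for i
    using closed[OF that] DE D_eq by blast
  have "h i \<in> \<Union>C" for i
    by (induction i) (use x h edge in auto)
  then show ?thesis using edge D_eq by blast
qed

text \<open>Otherwise \<open>D \<subseteq> C\<close>; then the vertices of \<open>D\<close> also
  have degree at most 2, and exchanging the roles gives \<open>C = D\<close>.\<close>

lemma meeting_cycles_degree:
  assumes "is_cycle \<Gamma> C" "is_cycle \<Gamma> D" "C \<noteq> D" "\<Union>C \<inter> \<Union>D \<noteq> {}"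
  shows "\<exists>v\<in>\<Union>C. deg v \<ge> 3"
proof (rule ccontr)
  assume "\<not> ?thesis"
  then have deg2: "deg v \<le> 2" if "v \<in> \<Union>C" for v using that by force
  then have "D \<subseteq> C" using cycle_edges_subset[of C D] assms by blast
  moreover have "C \<subseteq> D"
    using cycle_edges_subset[of D C] assms deg2 \<open>D \<subseteq> C\<close> by blast
  ultimately show False using assms(3) by blast
qed

text \<open>The walk processes \<open>g 1\<close> up to \<open>g (k - 1)\<close> and takes
  \<open>v = g 0\<close> last. Both cycle neighbours of \<open>v\<close> are then processed, which
  saves 1 as \<open>excess v\<close> is positive.\<close>

lemma cycle_cheaply_forces:
  assumes C: "is_cycle \<Gamma> C" and v: "v \<in> \<Union>C" "deg v \<ge> 3"
  shows "\<exists>S X. cheaply_forces 1 S X"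
proof -
  obtain k g where g: "k \<ge> 3" "g 0 = v" "\<forall>i j. g i = g j \<longleftrightarrow> i mod k = j mod k"
    "C = range (\<lambda>i. {g i, g (Suc i)})"
    using is_cycle_periodic[OF C v(1)] by blast
  have "C \<subseteq> E" using C by (simp add: is_cycle_def)
  then have nbr: "g i \<in> nbrs (g (Suc i))" for i using g(4) by (auto simp: nbrs_def)
  then have nbr': "g (Suc i) \<in> nbrs (g i)" for i using nbrs_sym by blast
  have inV: "g i \<in> V" for i using nbr' nbrs_subset in_V_of_nbr by blast
  have path: "\<exists>S. cheaply_forces 0 S (g ` {1..i})" if "1 \<le> i" "i < k" for i
    using that
  proof (induction i rule: dec_induct)
    case base
    have "deg (g 1) \<ge> 1"
      using nbr'[of 1] finite_nbrs[of "g 1"] by (auto simp: degree_eq Suc_le_eq card_gt_0_iff)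
    then obtain S where "cheaply_forces (if deg (g 1) = 1 then Suc 0 else 0) S {g 1}"
      using cheaply_forces_start[OF cheaply_forces_empty, of "g 1"] inV by auto
    then have "cheaply_forces 0 S {g 1}"
      by (auto simp: cheaply_forces_def split: if_splits)
    then show ?case by auto
  next
    case (step i)
    then obtain S where S: "cheaply_forces 0 S (g ` {1..i})" by auto
    have "g (Suc i) \<noteq> g j" if "j \<in> {1..i}" for j
      using that step.prems g(3)[rule_format, of "Suc i" j] by simp
    then have new: "g (Suc i) \<in> V - g ` {1..i}" using inV by blast
    have "{g i} \<subseteq> nbrs (g (Suc i)) \<inter> g ` {1..i}" using nbr step by auto
    from cheaply_forces_step[OF S new this, of 0] show ?case
      using step.hyps by (simp add: atLeastAtMostSuc_conv)
  qed
  have "1 \<le> k - 1" "k - 1 < k" using g(1) by simp_all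
  then obtain S where S: "cheaply_forces 0 S (g ` {1..k - 1})" using path by blast
  have "v \<noteq> g j" if "j \<in> {1..k - 1}" for j
  proof -
    have "j mod k = j" using that g(1) by (intro mod_less) auto
    then show ?thesis
      using that g(2) g(3)[rule_format, of 0 j] by (metis atLeastAtMost_iff mod_0 not_one_le_zero)
  qed
  then have new: "v \<in> V - g ` {1..k - 1}" using inV[of 0] g(2) by blast
  have "g (Suc (k - 1)) = v" using g(1,2) g(3)[rule_format, of k 0] by simp
  then have "{g 1, g (k - 1)} \<subseteq> nbrs v \<inter> g ` {1..k - 1}"
    using nbr[of "k - 1"] nbr'[of 0] g(1,2) by auto
  moreover have "card {g 1, g (k - 1)} = Suc 1"
    using g(1) g(3)[rule_format, of 1 "k - 1"] by simp
  moreover have "1 \<le> excess v" using v(2) by (simp add: excess_def)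
  ultimately have "\<exists>S'. cheaply_forces (0 + 1) S' (insert v (g ` {1..k - 1}))"
    by (rule cheaply_forces_step[OF S new])
  then show ?thesis by auto
qed

end

theorem theorem3p1:
  fixes \<Gamma> :: "'a signed_graph"
  assumes "signed_graph \<Gamma>"
    and "\<forall>K\<in>components \<Gamma>. card K \<ge> 2"
  shows "(pendant_number \<Gamma> \<ge> 1 \<longrightarrow>
            int (nullity \<Gamma>) \<le> 2 * cyclomatic_number \<Gamma> + int (pendant_number \<Gamma>) - 1) \<and>
         (pendant_number \<Gamma> = 0 \<and> cycle_disjoint \<Gamma> \<longrightarrow>
            int (nullity \<Gamma>) \<le> 2 * cyclomatic_number \<Gamma>) \<and>
         (pendant_number \<Gamma> = 0 \<and>
          (\<exists>C D. is_cycle \<Gamma> C \<and> is_cycle \<Gamma> D \<and> C \<noteq> D \<and> \<Union>C \<inter> \<Union>D \<noteq> {}) \<longrightarrow>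
            int (nullity \<Gamma>) \<le> 2 * cyclomatic_number \<Gamma> - 1)"
proof -
  interpret finite_signed_graph \<Gamma> by unfold_locales (rule assms)
  note le = nullity_le[OF assms(2)]
  have "int (nullity \<Gamma>) \<le> 2 * cyclomatic_number \<Gamma> + int (pendant_number \<Gamma>) - 1"
    if "pendant_number \<Gamma> \<ge> 1"
  proof -
    \<comment> \<open>The exploration starts at a pendant vertex, which saves 1.\<close>
    have "{v \<in> V. deg v = 1} \<noteq> {}"
      using that unfolding pendant_number_def by (metis card.empty not_one_le_zero)
    then obtain v where "v \<in> V" "deg v = 1" by blast
    then show ?thesis
      using cheaply_forces_start[OF cheaply_forces_empty, of v] le[of 1] by auto
  qed
  moreover have "int (nullity \<Gamma>) \<le> 2 * cyclomatic_number \<Gamma>" if "pendant_number \<Gamma> = 0"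
    using le[OF cheaply_forces_empty] that by simp
  moreover have "int (nullity \<Gamma>) \<le> 2 * cyclomatic_number \<Gamma> - 1"
    if "pendant_number \<Gamma> = 0" and "is_cycle \<Gamma> C" "is_cycle \<Gamma> D" "C \<noteq> D" "\<Union>C \<inter> \<Union>D \<noteq> {}" for C D
    using meeting_cycles_degree[OF that(2-5)] cycle_cheaply_forces[OF that(2)] le[of 1] that(1)
    by auto
  ultimately show ?thesis by blast
qed

end
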